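(* Let $(X,\|\cdot,\cdot,\cdot\|)$ be a $G$-normed space. Then the function $G\colon X^3\to\mathbb{R}^+$ defined by $$G(x,y,z)=\|x-y,\,y-z,\,z-x\|$$ is a $G$-metric on $X$.
   Context: A $G$-norm on a real vector space $X$ is a function $\|\cdot,\cdot,\cdot\|\colon X^3\to\mathbb{R}$ such that: [N1] $\|x,y,z\|\ge 0$, and $\|x,y,z\|=0$ if and only if $x=y=z=0$; [N2] $\|x,y,z\|$ is invariant under permutations of $x,y,z$; [N3] $\|\alpha x,\alpha y,\alpha z\|=|\alpha|\,\|x,y,z\|$ for all $\alpha\in\mathbb{R}$, $x,y,z\in X$; [N4] $\|x+x',y+y',z+z'\|\le\|x,y,z\|+\|x',y',z'\|$ for all $x,y,z,x',y',z'\in X$; [N5] $\|x,y,z\|\ge\|x+y,0,z\|$ for all $x,y,z\in X$. The pair $(X,\|\cdot,\cdot,\cdot\|)$ is then called a $G$-normed space. $\mathbb{R}^+$ denotes the set of non-negative real numbers. A $G$-metric on a non-empty set $X$ is a function $G\colon X\times X\times X\to\mathbb{R}^+$ such that: [G1] $G(x,y,z)=0$ if $x=y=z$; [G2] $G(x,x,y)>0$ for all $x,y\in X$ with $x\ne y$; [G3] $G(x,x,y)\le G(x,y,z)$ for all $x,y,z\in X$; [G4] $G(x,y,z)=G(y,z,x)=G(x,z,y)=\cdots$ (invariance under all permutations of the arguments) for all $x,y,z\in X$; [G5] $G(x,y,z)\le G(x,a,a)+G(a,y,z)$ for all $x,y,z,a\in X$. *)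

theory Defs
  imports Complex_Main
begin

definition perm_invariant_on :: "'a set \<Rightarrow> ('a \<Rightarrow> 'a \<Rightarrow> 'a \<Rightarrow> real) \<Rightarrow> bool" where
  "perm_invariant_on X f \<longleftrightarrow>
     (\<forall>x\<in>X. \<forall>y\<in>X. \<forall>z\<in>X.
        f x y z = f x z y \<and> f x y z = f y x z \<and> f x y z = f y z x \<and>
        f x y z = f z x y \<and> f x y z = f z y x)"

definition G_norm :: "('a::real_vector \<Rightarrow> 'a \<Rightarrow> 'a \<Rightarrow> real) \<Rightarrow> bool" where
  "G_norm N \<longleftrightarrow>
     (\<forall>x y z. N x y z \<ge> 0 \<and> (N x y z = 0 \<longleftrightarrow> x = 0 \<and> y = 0 \<and> z = 0)) \<and>
     perm_invariant_on UNIV N \<and>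
     (\<forall>\<alpha> x y z. N (\<alpha> *\<^sub>R x) (\<alpha> *\<^sub>R y) (\<alpha> *\<^sub>R z) = \<bar>\<alpha>\<bar> * N x y z) \<and>
     (\<forall>x y z x' y' z'. N (x + x') (y + y') (z + z') \<le> N x y z + N x' y' z') \<and>
     (\<forall>x y z. N x y z \<ge> N (x + y) 0 z)"

(* The nonnegativity conjunct expresses that G takes its values in the non-negative reals. *)
definition G_metric_on :: "'a set \<Rightarrow> ('a \<Rightarrow> 'a \<Rightarrow> 'a \<Rightarrow> real) \<Rightarrow> bool" where
  "G_metric_on X G \<longleftrightarrow>
     X \<noteq> {} \<and>
     (\<forall>x\<in>X. \<forall>y\<in>X. \<forall>z\<in>X. G x y z \<ge> 0) \<and>
     (\<forall>x\<in>X. \<forall>y\<in>X. \<forall>z\<in>X. x = y \<and> y = z \<longrightarrow> G x y z = 0) \<and>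
     (\<forall>x\<in>X. \<forall>y\<in>X. x \<noteq> y \<longrightarrow> G x x y > 0) \<and>
     (\<forall>x\<in>X. \<forall>y\<in>X. \<forall>z\<in>X. G x x y \<le> G x y z) \<and>
     perm_invariant_on X G \<and>
     (\<forall>x\<in>X. \<forall>y\<in>X. \<forall>z\<in>X. \<forall>a\<in>X. G x y z \<le> G x a a + G a y z)"

end

theory Submission
  imports Defs
begin

text \<open>Write \<open>G x y z\<close> for \<open>N (x - y) (y - z) (z - x)\<close>. The three differences sum to zero,
  so adding two of them yields the negative of the third; hence the inequality
  \<open>N (u + v) 0 w \<le> N u v w\<close> bounds \<open>G x x y\<close> by \<open>G x y z\<close>. A transposition of the points
  permutes the differences and negates all of them, so the symmetry of \<open>G\<close> follows from that
  of \<open>N\<close> together with homogeneity at \<open>-1\<close>. The differences of \<open>(x, a, a)\<close> and \<open>(a, y, z)\<close>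
  add up componentwise to those of \<open>(x, y, z)\<close>, so the last axiom is
  subadditivity.\<close>

theorem proposition2p3:
  fixes N :: "'a::real_vector \<Rightarrow> 'a \<Rightarrow> 'a \<Rightarrow> real"
  assumes "G_norm N"
  shows "G_metric_on UNIV (\<lambda>x y z. N (x - y) (y - z) (z - x))"
proof -
  have nonneg: "N x y z \<ge> 0"
    and zero_iff: "N x y z = 0 \<longleftrightarrow> x = 0 \<and> y = 0 \<and> z = 0"
    and swap12: "N x y z = N y x z" and rotate: "N x y z = N y z x"
    and scale: "N (c *\<^sub>R x) (c *\<^sub>R y) (c *\<^sub>R z) = \<bar>c\<bar> * N x y z"
    and triangle: "N (x + x') (y + y') (z + z') \<le> N x y z + N x' y' z'"
    and merge: "N (x + y) 0 z \<le> N x y z"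
    for x y z x' y' z' c
    using assms unfolding G_norm_def perm_invariant_on_def by blast+
  let ?G = "\<lambda>x y z. N (x - y) (y - z) (z - x)"
  have neg: "N (- x) (- y) (- z) = N x y z" for x y z
    using scale[of "-1" x y z] by simp
  have G_rotate: "?G x y z = ?G y z x" for x y z
    by (rule rotate)
  have G_swap: "?G x y z = ?G y x z" for x y z
  proof -
    have "?G x y z = N (y - x) (z - y) (x - z)"
      using neg[of "x - y" "y - z" "z - x"] by simp
    also have "\<dots> = ?G y x z"
      using swap12 rotate by metis
    finally show ?thesis .
  qed
  have perm: "perm_invariant_on UNIV ?G"
    unfolding perm_invariant_on_def using G_rotate G_swap by metis
  have pos: "?G x x y > 0" if "x \<noteq> y" for x y
  proof -
    have "?G x x y \<noteq> 0"
      using that by (simp add: zero_iff)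
    with nonneg[of "x - x" "x - y" "y - x"] show ?thesis
      by linarith
  qed
  have collapse_le: "?G x x y \<le> ?G x y z" for x y z
  proof -
    have "?G x x y = N (y - x) 0 (x - y)"
      using rotate[of "y - x" 0 "x - y"] by simp
    also have "\<dots> \<le> N (y - z) (z - x) (x - y)"
      using merge[of "y - z" "z - x" "x - y"] by simp
    also have "\<dots> = ?G x y z"
      by (rule rotate[symmetric])
    finally show ?thesis .
  qed
  have rectangle: "?G x y z \<le> ?G x a a + ?G a y z" for x y z a
    using triangle[of "x - a" "a - y" "a - a" "y - z" "a - x" "z - a"] by simp
  show ?thesis
    unfolding G_metric_on_def using nonneg pos collapse_le perm rectangle by (simp add: zero_iff)
qed

end
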